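(* Let $p \ge 3$ and $k \ge p+2$ be positive integers, and let $\Pi \subseteq S_k$ with $|\Pi| = p$. Then $\Pi$ is not symmetrically avoided; that is, there exists $n$ such that the set $S_n(\Pi)$ is not symmetric.
   Context: $S_n$ is the symmetric group on $[n]=\{1,\dots,n\}$, with permutations written in one-line notation $\sigma=[\sigma_1,\dots,\sigma_n]$. For $\pi\in S_k$ and $\sigma\in S_n$, $\sigma$ contains the pattern $\pi$ if there are indices $1\le i_1<\dots<i_k\le n$ such that for all $1\le j<j'\le k$, $\pi_j<\pi_{j'}\iff \sigma_{i_j}<\sigma_{i_{j'}}$; otherwise (or if $k>n$) $\sigma$ avoids $\pi$. $S_n(\Pi)$ is the set of permutations in $S_n$ avoiding every $\pi\in\Pi$. The descent set of $\pi\in S_n$ is $\operatorname{Des}(\pi)=\{i\in[n-1]:\pi_i>\pi_{i+1}\}$. For $S\subseteq[n-1]$, the fundamental quasisymmetric function is $F_S=\sum x_{i_1}x_{i_2}\cdots x_{i_n}$, summed over $i_1\le i_2\le\dots\le i_n$ (positive integers) with $i_j<i_{j+1}$ for all $j\in S$. For a set $A\subseteq S_n$, its quasisymmetric generating function is $\mathcal{Q}_n(A)=\sum_{\pi\in A}F_{\operatorname{Des}(\pi)}$, and $A$ is called symmetric if $\mathcal{Q}_n(A)$ is a symmetric function. A set $\Pi\subseteq S_k$ is symmetrically avoided if $S_n(\Pi)$ is symmetric for all $n$. *)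

theory Defs
  imports "HOL-Library.Poly_Mapping" "HOL-Library.FuncSet" "HOL-Combinatorics.Permutations"
begin

(* A permutation of [n] is a function nat => nat permuting {1..n}; its one-line notation is
   [\<sigma> 1, ..., \<sigma> n].  As the function does not determine n, sizes are passed explicitly. *)
definition Sym :: "nat \<Rightarrow> (nat \<Rightarrow> nat) set" where
  "Sym n = {\<sigma>. \<sigma> permutes {1..n}}"

(* When k > n there is no strictly increasing index map, so avoidance holds. *)
definition contains_pattern :: "nat \<Rightarrow> (nat \<Rightarrow> nat) \<Rightarrow> nat \<Rightarrow> (nat \<Rightarrow> nat) \<Rightarrow> bool" where
  "contains_pattern n \<sigma> k \<pi> \<longleftrightarrow>
    (\<exists>i :: nat \<Rightarrow> nat. i ` {1..k} \<subseteq> {1..n} \<and> strict_mono_on {1..k} i \<and>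
      (\<forall>j\<in>{1..k}. \<forall>j'\<in>{1..k}. j < j' \<longrightarrow> (\<pi> j < \<pi> j' \<longleftrightarrow> \<sigma> (i j) < \<sigma> (i j'))))"

definition Avoiders :: "nat \<Rightarrow> nat \<Rightarrow> (nat \<Rightarrow> nat) set \<Rightarrow> (nat \<Rightarrow> nat) set" where
  "Avoiders n k P = {\<sigma> \<in> Sym n. \<forall>\<pi>\<in>P. \<not> contains_pattern n \<sigma> k \<pi>}"

definition Des :: "nat \<Rightarrow> (nat \<Rightarrow> nat) \<Rightarrow> nat set" where
  "Des n \<pi> = {i \<in> {1..n - 1}. \<pi> i > \<pi> (i + 1)}"

(* A formal power series in x_1, x_2, ... is given by its coefficients; the exponent vector of a
   monomial is a finitely supported map from variable indices to exponents.  The index 0 is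
   unused: the series below have coefficient 0 at monomials involving it. *)
type_synonym mseries = "(nat \<Rightarrow>\<^sub>0 nat) \<Rightarrow> int"

(* The coefficient of x^m counts the admissible index sequences i_1, ..., i_n
   with x_{i_1} ... x_{i_n} = x^m; this set is finite. *)
definition fundamental_qsym :: "nat \<Rightarrow> nat set \<Rightarrow> mseries" where
  "fundamental_qsym n S = (\<lambda>m. int (card {i \<in> {1..n} \<rightarrow>\<^sub>E {1..}.
      (\<forall>j\<in>{1..n - 1}. i j \<le> i (j + 1)) \<and>
      (\<forall>j\<in>S. i j < i (j + 1)) \<and>
      (\<Sum>j\<in>{1..n}. Poly_Mapping.single (i j) 1) = m}))"

definition qsym_gf :: "nat \<Rightarrow> (nat \<Rightarrow> nat) set \<Rightarrow> mseries" where
  "qsym_gf n A = (\<lambda>m. \<Sum>\<pi>\<in>A. fundamental_qsym n (Des n \<pi>) m)"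

(* Invariance under all permutations of the variables x_1, x_2, ...  The boundedness of degree
   usually required of a symmetric function is automatic for qsym_gf n A, which is homogeneous
   of degree n. *)
definition symmetric_series :: "mseries \<Rightarrow> bool" where
  "symmetric_series f \<longleftrightarrow> (\<forall>w. w permutes {1..} \<longrightarrow> (\<forall>m. f (Poly_Mapping.map_key w m) = f m))"

definition symmetric_set :: "nat \<Rightarrow> (nat \<Rightarrow> nat) set \<Rightarrow> bool" where
  "symmetric_set n A \<longleftrightarrow> symmetric_series (qsym_gf n A)"

definition symmetrically_avoided :: "nat \<Rightarrow> (nat \<Rightarrow> nat) set \<Rightarrow> bool" where
  "symmetrically_avoided k P \<longleftrightarrow> (\<forall>n. symmetric_set n (Avoiders n k P))"

end

theory Submission imports Defs begin

text \<open>
  Size \<open>n = k\<close> already fails. There the avoiders are the complement of \<open>\<Pi>\<close> in \<open>S\<^sub>k\<close>, and since all of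
  \<open>S\<^sub>k\<close> is symmetric, so is \<open>\<Pi>\<close>. The monomial coefficients count the members of \<open>\<Pi>\<close> that ascend at
  all places of a given set. For \<open>i \<in> [k-1]\<close> let \<open>u\<^sub>i \<in> {0,1}\<^bsup>\<Pi>\<^esup>\<close> be the indicator of \<open>\<pi>\<^sub>i < \<pi>\<^sub>i\<^sub>+\<^sub>1\<close>;
  symmetry says that the inner products of these \<open>k-1\<close> vectors have only three values: \<open>E\<close> on the
  diagonal, \<open>a\<close> for adjacent and \<open>b\<close> for non-adjacent indices. If \<open>2\<bar>a-b\<bar> \<le> E-b\<close>, the Gram matrix is
  positive definite, so \<open>\<bar>\<Pi>\<bar> \<ge> k-1\<close>. Otherwise \<open>a\<close> is much smaller than \<open>b\<close>, and evaluating the Gram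
  form at vectors with coordinate sum zero forces \<open>E-b\<close>, and with it \<open>\<bar>\<Pi>\<bar>\<close>, to be large.
\<close>

section \<open>Integer solutions of underdetermined linear systems\<close>

text \<open>Gaussian elimination without division: induction on the equations \<open>R\<close>,
  where one unknown with a nonzero coefficient is eliminated together with one equation.\<close>

lemma nontrivial_integer_solution:
  fixes c :: "'i \<Rightarrow> 'r \<Rightarrow> int"
  assumes "finite R" "finite I" "card R < card I"
  shows "\<exists>z. (\<exists>i\<in>I. z i \<noteq> 0) \<and> (\<forall>r\<in>R. (\<Sum>i\<in>I. z i * c i r) = 0)"
  using assms
proof (induction R arbitrary: I c rule: finite_induct)
  case empty
  then have "I \<noteq> {}" by auto
  then show ?case by (intro exI[of _ "\<lambda>_. 1"]) auto
next
  case (insert r R)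
  show ?case
  proof (cases "\<forall>i\<in>I. c i r = 0")
    case True
    from insert.prems insert.hyps have "card R < card I" by simp
    from insert.IH[OF \<open>finite I\<close> this, of c] True show ?thesis by force
  next
    case False
    then obtain l where l: "l \<in> I" "c l r \<noteq> 0" by blast
    define J where "J = I - {l}"
    have J: "finite J" "l \<notin> J" "I = insert l J" using insert.prems l by (auto simp: J_def)
    then have "card R < card J" using insert.prems insert.hyps by simp
    from insert.IH[OF \<open>finite J\<close> this, of "\<lambda>i s. c l r * c i s - c i r * c l s"]
    obtain z i where z: "i \<in> J" "z i \<noteq> 0"
      and sol: "\<And>s. s \<in> R \<Longrightarrow> (\<Sum>i\<in>J. z i * (c l r * c i s - c i r * c l s)) = 0" by blast
    \<comment> \<open>Scaling the other unknowns by the pivot \<open>c l r\<close> keeps everything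
      integral, and the value at \<open>l\<close> is the one that makes equation \<open>r\<close>
      hold.\<close>
    define y where "y = (\<lambda>i. if i = l then - (\<Sum>j\<in>J. z j * c j r) else c l r * z i)"
    have y_sum: "(\<Sum>i\<in>I. y i * c i s) = (\<Sum>i\<in>J. z i * (c l r * c i s - c i r * c l s))" for s
    proof -
      have "(\<Sum>i\<in>J. y i * c i s) = (\<Sum>i\<in>J. c l r * z i * c i s)"
        using J by (intro sum.cong) (auto simp: y_def)
      then show ?thesis
        using J by (simp add: y_def sum_distrib_left sum_subtractf algebra_simps)
    qed
    have "y i \<noteq> 0" "i \<in> I" using z l J by (auto simp: y_def)
    moreover have "(\<Sum>i\<in>I. y i * c i s) = 0" if "s \<in> insert r R" for s
      using that sol by (auto simp: y_sum)
    ultimately show ?thesis by blast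
  qed
qed

section \<open>Gram matrices of 0/1 vectors with three values\<close>

locale adjacency_gram =
  fixes R :: "'r set" and u :: "nat \<Rightarrow> 'r \<Rightarrow> int" and m :: nat and E a b :: int
  assumes finite_R: "finite R"
    and u_01: "\<And>i r. u i r = 0 \<or> u i r = 1"
    and gram: "\<And>i j. i \<in> {1..m} \<Longrightarrow> j \<in> {1..m} \<Longrightarrow>
      (\<Sum>r\<in>R. u i r * u j r) = (if i = j then E else if j = i + 1 \<or> i = j + 1 then a else b)"
begin

text \<open>The Gram matrix is \<open>b\<close> times the all-ones matrix plus a tridiagonal matrix
  with \<open>E - b\<close> on the diagonal and \<open>a - b\<close> beside it. Allowing
  \<open>n \<le> m\<close> admits test vectors supported on an initial segment.\<close>

lemma quadratic_form:
  assumes "n \<le> m"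
  shows "(\<Sum>r\<in>R. (\<Sum>i\<in>{1..n}. z i * u i r)\<^sup>2) =
    (E - b) * (\<Sum>i\<in>{1..n}. (z i)\<^sup>2) + 2 * (a - b) * (\<Sum>i\<in>{1..<n}. z i * z (i + 1))
      + b * (\<Sum>i\<in>{1..n}. z i)\<^sup>2"
proof -
  have "(\<Sum>r\<in>R. (\<Sum>i\<in>{1..n}. z i * u i r)\<^sup>2)
      = (\<Sum>r\<in>R. \<Sum>i\<in>{1..n}. \<Sum>j\<in>{1..n}. z i * z j * (u i r * u j r))"
    by (simp add: power2_eq_square sum_product mult_ac)
  also have "\<dots> = (\<Sum>i\<in>{1..n}. \<Sum>r\<in>R. \<Sum>j\<in>{1..n}. z i * z j * (u i r * u j r))"
    by (rule sum.swap)
  also have "\<dots> = (\<Sum>i\<in>{1..n}. \<Sum>j\<in>{1..n}. \<Sum>r\<in>R. z i * z j * (u i r * u j r))"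
    by (intro sum.cong refl sum.swap)
  also have "\<dots> = (\<Sum>i\<in>{1..n}. \<Sum>j\<in>{1..n}. z i * z j * (\<Sum>r\<in>R. u i r * u j r))"
    by (simp add: sum_distrib_left)
  also have "\<dots> = (\<Sum>i\<in>{1..n}. \<Sum>j\<in>{1..n}. b * (z i * z j)
      + (if i = j then (E - b) * (z i * z j) else 0)
      + (if j = i + 1 then (a - b) * (z i * z j) else 0)
      + (if i = j + 1 then (a - b) * (z i * z j) else 0))"
  proof (intro sum.cong refl, goal_cases)
    case (1 i j)
    then show ?case using gram[of i j] assms by (auto simp: algebra_simps)
  qed
  also have "\<dots> = b * (\<Sum>i\<in>{1..n}. z i)\<^sup>2 + (E - b) * (\<Sum>i\<in>{1..n}. (z i)\<^sup>2)
      + (\<Sum>i\<in>{1..n}. \<Sum>j\<in>{1..n}. if j = i + 1 then (a - b) * (z i * z j) else 0)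
      + (\<Sum>i\<in>{1..n}. \<Sum>j\<in>{1..n}. if i = j + 1 then (a - b) * (z i * z j) else 0)"
    by (simp add: sum.distrib power2_eq_square sum_product) (simp add: sum_distrib_left)
  also have "(\<Sum>i\<in>{1..n}. \<Sum>j\<in>{1..n}. if i = j + 1 then (a - b) * (z i * z j) else 0)
      = (\<Sum>i\<in>{1..n}. \<Sum>j\<in>{1..n}. if j = i + 1 then (a - b) * (z i * z j) else 0)"
    by (subst sum.swap) (intro sum.cong refl, simp add: mult_ac)
  also have "\<dots> = (\<Sum>i\<in>{1..n}. if i \<in> {1..<n} then (a - b) * (z i * z (i + 1)) else 0)"
    by (intro sum.cong refl) auto
  also have "\<dots> = (\<Sum>i\<in>{1..<n}. (a - b) * (z i * z (i + 1)))"
    by (subst sum.inter_restrict[symmetric]) (auto intro!: sum.cong)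
  finally show ?thesis by (simp add: sum_distrib_left algebra_simps)
qed

text \<open>The form is a sum of squares, and coordinate sum zero kills its all-ones part, so only
  \<open>E - b\<close> and \<open>a - b\<close> remain to be compared.\<close>

lemma balanced_form_nonneg:
  assumes "n \<le> m" "(\<Sum>i\<in>{1..n}. z i) = 0"
  shows "0 \<le> (E - b) * (\<Sum>i\<in>{1..n}. (z i)\<^sup>2) + 2 * (a - b) * (\<Sum>i\<in>{1..<n}. z i * z (i + 1))"
proof -
  have "0 \<le> (\<Sum>r\<in>R. (\<Sum>i\<in>{1..n}. z i * u i r)\<^sup>2)" by (intro sum_nonneg) simp
  then show ?thesis using quadratic_form[OF assms(1), of z] assms(2) by simp
qed

text \<open>With fewer than \<open>m\<close> rows the columns satisfy a nontrivial linear relation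
  \<open>z\<close>, at which the form vanishes. The bound on \<open>a - b\<close> makes the form
  positive definite, so \<open>z\<close> would be zero.\<close>

lemma card_ge_of_small_offdiagonal:
  assumes "0 < E - b" "0 \<le> b" "\<bar>2 * (a - b)\<bar> \<le> E - b"
  shows "m \<le> card R"
proof (rule ccontr)
  assume "\<not> m \<le> card R"
  then have "card R < card {1..m}" by simp
  from nontrivial_integer_solution[OF finite_R _ this, of u]
  obtain z l where l: "l \<in> {1..m}" "z l \<noteq> 0"
    and sol: "\<And>r. r \<in> R \<Longrightarrow> (\<Sum>i\<in>{1..m}. z i * u i r) = 0" by auto
  define x where "x = E - b"
  define A where "A = (\<Sum>i\<in>{1..<m}. \<bar>z i\<bar> * \<bar>z (i + 1)\<bar>)"
  have form: "x * (\<Sum>i\<in>{1..m}. (z i)\<^sup>2) + 2 * (a - b) * (\<Sum>i\<in>{1..<m}. z i * z (i + 1))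
      + b * (\<Sum>i\<in>{1..m}. z i)\<^sup>2 = 0"
    using quadratic_form[of m z] sol by (simp add: x_def)
  have "\<bar>\<Sum>i\<in>{1..<m}. z i * z (i + 1)\<bar> \<le> A"
    unfolding A_def by (rule order_trans[OF sum_abs]) (simp add: abs_mult)
  then have "\<bar>2 * (a - b) * (\<Sum>i\<in>{1..<m}. z i * z (i + 1))\<bar> \<le> x * A"
    unfolding abs_mult[of "2 * (a - b)"] using assms by (intro mult_mono) (auto simp: x_def)
  moreover have "0 \<le> b * (\<Sum>i\<in>{1..m}. z i)\<^sup>2" using assms by simp
  ultimately have "x * ((\<Sum>i\<in>{1..m}. (z i)\<^sup>2) - A) \<le> 0"
    using form by (simp add: algebra_simps)
  then have le: "(\<Sum>i\<in>{1..m}. (z i)\<^sup>2) \<le> A" using assms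
    by (simp add: x_def mult_le_0_iff)
  have m: "1 \<le> m" using l by simp
  \<comment> \<open>Completing squares along the path 1, ..., \<open>m\<close>. Each inner square is
    shared by two neighbours, so one copy of each end square is left over; these anchor
    \<open>z\<close> at zero.\<close>
  have "2 * (\<Sum>i\<in>{1..m}. (z i)\<^sup>2) - 2 * A
      = (z 1)\<^sup>2 + (z m)\<^sup>2 + (\<Sum>i\<in>{1..<m}. (\<bar>z i\<bar> - \<bar>z (i + 1)\<bar>)\<^sup>2)"
    using m unfolding A_def
  proof (induction m rule: dec_induct)
    case base
    then show ?case by simp
  next
    case (step n)
    then show ?case by (simp add: power2_eq_square algebra_simps flip: abs_mult)
  qed
  with le have eq: "(z 1)\<^sup>2 + (z m)\<^sup>2 + (\<Sum>i\<in>{1..<m}. (\<bar>z i\<bar> - \<bar>z (i + 1)\<bar>)\<^sup>2) \<le> 0" by simp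
  have nn: "0 \<le> (\<Sum>i\<in>{1..<m}. (\<bar>z i\<bar> - \<bar>z (i + 1)\<bar>)\<^sup>2)" by (intro sum_nonneg) simp
  have sq: "0 \<le> (z 1)\<^sup>2" "0 \<le> (z m)\<^sup>2" by simp_all
  have "(z 1)\<^sup>2 = 0" using eq nn sq by linarith
  then have z1: "z 1 = 0" by simp
  have "(\<Sum>i\<in>{1..<m}. (\<bar>z i\<bar> - \<bar>z (i + 1)\<bar>)\<^sup>2) = 0" using eq nn sq by linarith
  then have abs_eq: "\<bar>z i\<bar> = \<bar>z (i + 1)\<bar>" if "i \<in> {1..<m}" for i
    using that by (subst (asm) sum_nonneg_eq_0_iff) auto
  have "1 \<le> i \<Longrightarrow> i \<le> m \<Longrightarrow> z i = 0" for i
  proof (induction i rule: dec_induct)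
    case base
    then show ?case by (simp add: z1 del: One_nat_def)
  next
    case (step n)
    then show ?case using abs_eq[of n] by simp
  qed
  then show False using l by simp
qed

text \<open>The nonconstant row \<open>r\<close> rules out that all columns are equal. Small
  \<open>a - b\<close> is settled by definiteness; otherwise counting rows that are nonconstant on
  the first three columns bounds \<open>card R\<close> from below by a multiple of
  \<open>E - b\<close>.\<close>

lemma card_ge:
  assumes "4 \<le> m" "r \<in> R" "i \<in> {1..<m}" "u i r \<noteq> u (i + 1) r"
  shows "m \<le> card R"
proof -
  define x y where "x = E - b" and "y = a - b"
  note xy = x_def y_def
  have row: "(\<Sum>r\<in>R. u 1 r * u 1 r) = E" "(\<Sum>r\<in>R. u 2 r * u 2 r) = E" "(\<Sum>r\<in>R. u 3 r * u 3 r) = E"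
    "(\<Sum>r\<in>R. u 1 r * u 2 r) = a" "(\<Sum>r\<in>R. u 2 r * u 3 r) = a" "(\<Sum>r\<in>R. u 1 r * u 3 r) = b"
    using gram[of 1 1] gram[of 2 2] gram[of 3 3] gram[of 1 2] gram[of 2 3] gram[of 1 3] assms(1)
    by simp_all
  \<comment> \<open>Among 0/1 values \<open>u 2 r\<close> is an extreme one, so the two differences
    never have opposite signs.\<close>
  have "0 \<le> (\<Sum>r\<in>R. (u 1 r - u 2 r) * (u 3 r - u 2 r))"
  proof (intro sum_nonneg)
    show "0 \<le> (u 1 r - u 2 r) * (u 3 r - u 2 r)" for r
      using u_01[of 1 r] u_01[of 2 r] u_01[of 3 r] by auto
  qed
  also have "\<dots> = (\<Sum>r\<in>R. u 1 r * u 3 r) - (\<Sum>r\<in>R. u 1 r * u 2 r) - (\<Sum>r\<in>R. u 2 r * u 3 r)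
      + (\<Sum>r\<in>R. u 2 r * u 2 r)"
    by (simp add: sum.distrib sum_subtractf algebra_simps)
  finally have y_le: "2 * y \<le> x" unfolding row by (simp add: xy)
  \<comment> \<open>The summand is 1 if the first three entries of row \<open>r\<close> are not all equal, and 0 otherwise.\<close>
  have "(\<Sum>r\<in>R. u 1 r * u 1 r + u 2 r * u 2 r + u 3 r * u 3 r - u 1 r * u 2 r - u 2 r * u 3 r - u 1 r * u 3 r)
      \<le> (\<Sum>r\<in>R. 1)"
  proof (intro sum_mono)
    show "u 1 r * u 1 r + u 2 r * u 2 r + u 3 r * u 3 r - u 1 r * u 2 r - u 2 r * u 3 r - u 1 r * u 3 r \<le> 1" for r
      using u_01[of 1 r] u_01[of 2 r] u_01[of 3 r] by auto
  qed
  then have card: "3 * x - 2 * y \<le> int (card R)"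
    unfolding sum.distrib sum_subtractf row by (simp add: xy)
  have b_nonneg: "0 \<le> b"
    unfolding row(6)[symmetric] using u_01 by (intro sum_nonneg) (metis mult_nonneg_nonneg order_refl zero_le_one)
  have "0 < (\<Sum>r\<in>R. (u i r - u (i + 1) r)\<^sup>2)"
    using assms finite_R by (intro sum_pos2[of _ r]) auto
  also have "\<dots> = (\<Sum>r\<in>R. u i r * u i r) + (\<Sum>r\<in>R. u (i + 1) r * u (i + 1) r) - 2 * (\<Sum>r\<in>R. u i r * u (i + 1) r)"
    by (simp add: power2_eq_square sum.distrib sum_subtractf sum_distrib_left algebra_simps)
  also have "\<dots> = 2 * (x - y)"
    using gram[of i i] gram[of "i + 1" "i + 1"] gram[of i "i + 1"] assms(3) by (simp add: xy)
  finally have y_less: "y < x" by simp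
  show ?thesis
  proof (cases "- (2 * y) \<le> x")
    case True
    then show ?thesis
      using y_le y_less b_nonneg by (intro card_ge_of_small_offdiagonal) (auto simp: xy)
  next
    case False
    then have y_neg: "x + 1 \<le> - (2 * y)" by simp
    have card': "4 * x + 1 \<le> int (card R)" using card y_neg by linarith
    \<comment> \<open>By \<open>card'\<close> it suffices that \<open>m \<le> 4 * x + 1\<close>, so
      a lower bound on \<open>x\<close> is wanted. The generic test vector below, with
      \<open>h = (m - 1) div 2\<close>, gives \<open>x \<ge> h - 1\<close>, which is enough when
      \<open>m \<le> 4 * h - 3\<close>; for \<open>m \<ge> 4\<close> this fails only at 4 and
      6.\<close>
    consider "m = 4" | "m = 6" | "m = 5 \<or> 7 \<le> m" using assms(1) by linarith
    then show ?thesis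
    proof cases
      case 1
      define z where "z = (\<lambda>i::nat. if i \<le> 2 then 1 else - 1 :: int)"
      have "{1..4} = {1,2,3,4::nat}" "{1..<4} = {1,2,3::nat}" by auto
      with balanced_form_nonneg[of 4 z] 1 have "0 \<le> 4 * x + 2 * y"
        by (simp add: z_def xy)
      with y_neg have "1 \<le> x" using y_less by linarith
      then show ?thesis using card' 1 by linarith
    next
      case 2
      \<comment> \<open>The weights 1, 2, 1 are needed to reach \<open>x \<ge> 2\<close>: plain
        signs 1, 1, 1, -1, -1, -1 would give only \<open>x \<ge> 1\<close>, hence 5 rows.\<close>
      define z where "z = (\<lambda>i::nat. [1, 2, 1, -1, -2, -1] ! (i - 1) :: int)"
      have "{1..6} = {1,2,3,4,5,6::nat}" "{1..<6} = {1,2,3,4,5::nat}" by auto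
      with balanced_form_nonneg[of 6 z] 2 have "0 \<le> 12 * x + 14 * y"
        by (simp add: z_def xy)
      with y_neg have "2 \<le> x" by linarith
      then show ?thesis using card' 2 by linarith
    next
      case 3
      define h where "h = (m - 1) div 2"
      have h: "2 \<le> h" "2 * h + 1 \<le> m" "m \<le> 4 * h - 3" using 3 by (auto simp: h_def)
      \<comment> \<open>The zero in the middle removes the negative product at the sign change, so
        all nonzero neighbour products are 1.\<close>
      define z where "z = (\<lambda>i. if i \<le> h then 1 else if i = h + 1 then 0 else - 1 :: int)"
      have split: "{1..2 * h + 1} = {1..h} \<union> {h + 1} \<union> {h + 2..2 * h + 1}" by auto
      have split': "{1..<2 * h + 1} = {1..<h} \<union> {h, h + 1} \<union> {h + 2..<2 * h + 1}" using h by auto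
      have S: "(\<Sum>i\<in>{1..2 * h + 1}. f (z i)) = int h * f 1 + f 0 + int h * f (- 1)" for f :: "int \<Rightarrow> int"
      proof -
        have "(\<Sum>i\<in>{1..h}. f (z i)) = (\<Sum>i\<in>{1..h}. f 1)"
          by (intro sum.cong) (auto simp: z_def)
        moreover have "(\<Sum>i\<in>{h + 2..2 * h + 1}. f (z i)) = (\<Sum>i\<in>{h + 2..2 * h + 1}. f (- 1))"
          by (intro sum.cong) (auto simp: z_def)
        ultimately show ?thesis unfolding split
          by (subst sum.union_disjoint, simp, simp, force)+ (simp add: z_def)
      qed
      have T: "(\<Sum>i\<in>{1..<2 * h + 1}. z i * z (i + 1)) = 2 * (int h - 1)"
      proof -
        have "(\<Sum>i\<in>{1..<h}. z i * z (i + 1)) = (\<Sum>i\<in>{1..<h}. 1)"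
          by (intro sum.cong) (auto simp: z_def)
        moreover have "(\<Sum>i\<in>{h + 2..<2 * h + 1}. z i * z (i + 1)) = (\<Sum>i\<in>{h + 2..<2 * h + 1}. 1)"
          by (intro sum.cong) (auto simp: z_def)
        ultimately show ?thesis unfolding split' using h
          by (subst sum.union_disjoint, simp, simp, force)+ (simp add: z_def of_nat_diff)
      qed
      have "0 \<le> x * (2 * int h) + 2 * y * (2 * (int h - 1))"
        using balanced_form_nonneg[of "2 * h + 1" z] h S[of "\<lambda>t. t"] S[of "\<lambda>t. t\<^sup>2"] T
        by (simp add: xy)
      moreover have "(x + 1) * (int h - 1) \<le> - (2 * y) * (int h - 1)"
        using y_neg h by (intro mult_right_mono) auto
      ultimately have "int h - 1 \<le> x" by (simp add: algebra_simps)
      then show ?thesis using card' h by linarith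
    qed
  qed
qed

end

section \<open>Permutations and patterns of full size\<close>

text \<open>The complements of \<open>B\<close> and of its image have equal size, so any bijection
  between them completes \<open>g\<close>. This later turns partial moves of positions into
  permutations.\<close>

lemma permutation_extending:
  assumes "finite A" "B \<subseteq> A" "inj_on g B" "g ` B \<subseteq> A"
  obtains \<rho> where "\<rho> permutes A" "\<And>x. x \<in> B \<Longrightarrow> \<rho> x = g x"
proof -
  have fin: "finite B" "finite (A - B)" "finite (A - g ` B)" using assms finite_subset by auto
  have "card (A - B) = card (A - g ` B)"
    using assms fin by (simp add: card_Diff_subset card_image)
  then obtain f where f: "bij_betw f (A - B) (A - g ` B)"
    using fin finite_same_card_bij by blast
  define \<rho> where "\<rho> = (\<lambda>x. if x \<in> B then g x else if x \<in> A then f x else x)"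
  have "bij_betw \<rho> B (g ` B)"
    using assms by (simp add: bij_betw_def \<rho>_def inj_on_def)
  moreover have "bij_betw \<rho> (A - B) (A - g ` B)"
    using f by (rule bij_betw_cong[THEN iffD1, rotated]) (auto simp: \<rho>_def)
  ultimately have "bij_betw \<rho> (B \<union> (A - B)) (g ` B \<union> (A - g ` B))"
    by (rule bij_betw_combine) auto
  moreover have "B \<union> (A - B) = A" "g ` B \<union> (A - g ` B) = A" using assms by auto
  ultimately have "\<rho> permutes A"
    using assms(2) by (intro bij_imp_permutes) (auto simp: \<rho>_def)
  then show ?thesis by (rule that) (simp add: \<rho>_def)
qed

text \<open>Each value of a permutation is its rank, the number of entries not exceeding it, and
  ranks depend on the relative order alone.\<close>

lemma permutation_eq_of_same_order:
  assumes "\<pi> permutes {1..k}" "\<sigma> permutes {1..k::nat}"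
    and "\<And>j j'. j \<in> {1..k} \<Longrightarrow> j' \<in> {1..k} \<Longrightarrow> j < j' \<Longrightarrow> \<pi> j < \<pi> j' \<longleftrightarrow> \<sigma> j < \<sigma> j'"
  shows "\<pi> = \<sigma>"
proof
  have rank: "\<tau> j = card {l \<in> {1..k}. \<tau> l \<le> \<tau> j}" if "\<tau> permutes {1..k}" "j \<in> {1..k}" for \<tau> j
  proof -
    have "\<tau> j \<in> {1..k}" using that by (simp only: permutes_in_image)
    have "\<tau> ` {l \<in> {1..k}. \<tau> l \<le> \<tau> j} = {1..\<tau> j}"
    proof (intro equalityI subsetI)
      fix y assume "y \<in> {1..\<tau> j}"
      then have "y \<in> \<tau> ` {1..k}" using \<open>\<tau> j \<in> {1..k}\<close> permutes_image[OF that(1)] by simp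
      then show "y \<in> \<tau> ` {l \<in> {1..k}. \<tau> l \<le> \<tau> j}" using \<open>y \<in> {1..\<tau> j}\<close> by auto
    qed (use permutes_image[OF that(1)] in fastforce)
    moreover have "inj_on \<tau> {l \<in> {1..k}. \<tau> l \<le> \<tau> j}"
      using permutes_inj_on[OF that(1)] .
    ultimately show ?thesis using card_image by fastforce
  qed
  have le: "\<pi> l \<le> \<pi> j \<longleftrightarrow> \<sigma> l \<le> \<sigma> j" if "l \<in> {1..k}" "j \<in> {1..k}" for l j
    using that assms(3)[of l j] assms(3)[of j l]
      permutes_inj[OF assms(1), THEN inj_eq, of l j] permutes_inj[OF assms(2), THEN inj_eq, of l j]
    by (cases l j rule: linorder_cases) auto
  fix j
  show "\<pi> j = \<sigma> j"
  proof (cases "j \<in> {1..k}")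
    case True
    then have "{l \<in> {1..k}. \<pi> l \<le> \<pi> j} = {l \<in> {1..k}. \<sigma> l \<le> \<sigma> j}" using le by auto
    then show ?thesis using rank[OF assms(1) True] rank[OF assms(2) True] by simp
  next
    case False
    then show ?thesis using assms permutes_not_in by metis
  qed
qed

text \<open>Such a map is onto, so it carries the initial segment up to \<open>j\<close> onto the
  one up to \<open>i j\<close>; the two have equal size.\<close>

lemma strict_mono_on_self_map_eq_id:
  assumes "i ` {1..k} \<subseteq> {1..k}" "strict_mono_on {1..k} i" "j \<in> {1..k::nat}"
  shows "i j = j"
proof -
  have inj: "inj_on i {1..k}" using assms(2) by (rule strict_mono_on_imp_inj_on)
  then have surj: "i ` {1..k} = {1..k}" using assms(1) by (intro endo_inj_surj) auto
  have mono: "i l \<le> i j \<longleftrightarrow> l \<le> j" if "l \<in> {1..k}" for l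
    using assms(2,3) that by (simp add: strict_mono_on_less_eq)
  have "i ` {1..j} = {1..i j}"
  proof (intro equalityI subsetI)
    fix y assume y: "y \<in> {1..i j}"
    have "i j \<in> {1..k}" using assms(1,3) by blast
    then have "y \<in> i ` {1..k}" using y surj by auto
    then show "y \<in> i ` {1..j}" using y mono by auto
  next
    fix y assume "y \<in> i ` {1..j}"
    then obtain l where l: "y = i l" "l \<in> {1..j}" by blast
    then have "l \<in> {1..k}" using assms(3) by auto
    then show "y \<in> {1..i j}" using l mono assms(1) by fastforce
  qed
  moreover have "inj_on i {1..j}" using inj assms(3) by (auto intro: inj_on_subset)
  ultimately show ?thesis using card_image[of i "{1..j}"] by simp
qed

lemma contains_pattern_same_size_iff:
  assumes "\<sigma> \<in> Sym k" "\<pi> \<in> Sym k"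
  shows "contains_pattern k \<sigma> k \<pi> \<longleftrightarrow> \<sigma> = \<pi>"
proof
  assume "contains_pattern k \<sigma> k \<pi>"
  then obtain i where i: "i ` {1..k} \<subseteq> {1..k}" "strict_mono_on {1..k} i"
    and ord: "\<forall>j\<in>{1..k}. \<forall>j'\<in>{1..k}. j < j' \<longrightarrow> (\<pi> j < \<pi> j' \<longleftrightarrow> \<sigma> (i j) < \<sigma> (i j'))"
    unfolding contains_pattern_def by blast
  have "\<pi> = \<sigma>"
    using assms ord strict_mono_on_self_map_eq_id[OF i]
    by (intro permutation_eq_of_same_order[of _ k]) (auto simp: Sym_def)
  then show "\<sigma> = \<pi>" by simp
next
  assume "\<sigma> = \<pi>"
  then show "contains_pattern k \<sigma> k \<pi>"
    unfolding contains_pattern_def by (intro exI[of _ "\<lambda>j. j"]) (auto simp: strict_mono_on_def)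
qed

lemma Avoiders_same_size:
  assumes "P \<subseteq> Sym k"
  shows "Avoiders k k P = Sym k - P"
  using assms contains_pattern_same_size_iff unfolding Avoiders_def by blast

section \<open>Coefficients of quasisymmetric generating functions\<close>

lemma count_image_mset_eq_lookup:
  assumes "finite A"
  shows "count (image_mset f (mset_set A)) v =
    Poly_Mapping.lookup (\<Sum>j\<in>A. Poly_Mapping.single (f j) 1) v"
  using assms
  by (induction A rule: finite_induct) (auto simp: lookup_add lookup_single)

text \<open>The exponent vector records the multiset of letters, and a multiset has only one weakly
  increasing listing.\<close>

lemma sum_single_determines_sorted_word:
  fixes f g :: "nat \<Rightarrow> nat"
  assumes "(\<Sum>j\<in>{1..n}. Poly_Mapping.single (f j) (1::nat)) = (\<Sum>j\<in>{1..n}. Poly_Mapping.single (g j) 1)"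
    and f: "\<forall>j\<in>{1..n - 1}. f j \<le> f (j + 1)" and g: "\<forall>j\<in>{1..n - 1}. g j \<le> g (j + 1)"
    and "j \<in> {1..n}"
  shows "f j = g j"
proof -
  have "image_mset f (mset_set {1..n}) = image_mset g (mset_set {1..n})"
    by (rule multiset_eqI) (simp only: count_image_mset_eq_lookup finite_atLeastAtMost assms(1))
  moreover have "mset (map h [1..<Suc n]) = image_mset h (mset_set {1..n})" for h :: "nat \<Rightarrow> nat"
    by (simp only: mset_map mset_upt atLeastLessThanSuc_atLeastAtMost)
  moreover have "sorted (map h [1..<Suc n])" if "\<forall>j\<in>{1..n - 1}. h j \<le> h (j + 1)" for h :: "nat \<Rightarrow> nat"
    unfolding sorted_iff_nth_Suc
  proof (intro allI impI)
    fix l assume "Suc l < length (map h [1..<Suc n])"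
    then show "map h [1..<Suc n] ! l \<le> map h [1..<Suc n] ! Suc l"
      using bspec[OF that, of "Suc l"] by (simp del: upt_Suc)
  qed
  ultimately have "map f [1..<Suc n] = map g [1..<Suc n]"
    using f g by (metis properties_for_sort)
  then show ?thesis using assms(4) by (simp add: map_eq_conv del: upt_Suc)
qed

definition word_monomial :: "nat \<Rightarrow> (nat \<Rightarrow> nat) \<Rightarrow> nat \<Rightarrow>\<^sub>0 nat" where
  "word_monomial n f = (\<Sum>j\<in>{1..n}. Poly_Mapping.single (f j) 1)"

text \<open>At most one index sequence is counted, namely the word \<open>f\<close> itself, so the
  coefficient is 0 or 1 according to whether \<open>f\<close> is strict on \<open>S\<close>.\<close>

lemma fundamental_qsym_word_monomial:
  assumes "\<And>j. j \<in> {1..n} \<Longrightarrow> 1 \<le> f j" and f: "\<forall>j\<in>{1..n - 1}. f j \<le> f (j + 1)"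
    and S: "S \<subseteq> {1..n - 1}"
  shows "fundamental_qsym n S (word_monomial n f) = of_bool (\<forall>j\<in>S. f j < f (j + 1))"
proof -
  let ?X = "{i \<in> {1..n} \<rightarrow>\<^sub>E {1..}. (\<forall>j\<in>{1..n - 1}. i j \<le> i (j + 1)) \<and>
      (\<forall>j\<in>S. i j < i (j + 1)) \<and> (\<Sum>j\<in>{1..n}. Poly_Mapping.single (i j) 1) = word_monomial n f}"
  \<comment> \<open>The counted sequences are extensional, hence the restriction.\<close>
  define w where "w = restrict f {1..n}"
  have w: "w j = f j" if "j \<in> {1..n}" for j using that by (simp add: w_def)
  have "i = w" if "i \<in> ?X" for i
  proof
    fix j
    show "i j = w j"
    proof (cases "j \<in> {1..n}")
      case True
      then show ?thesis
        using that f w sum_single_determines_sorted_word[of i n f j] by (simp add: word_monomial_def)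
    next
      case False
      then show ?thesis using that by (simp only: w_def) (auto simp: PiE_def extensional_def)
    qed
  qed
  moreover have "w \<in> ?X \<longleftrightarrow> (\<forall>j\<in>S. f j < f (j + 1))"
  proof -
    have "w \<in> {1..n} \<rightarrow>\<^sub>E {1..}" using assms(1) by (auto simp: w_def)
    moreover have "(\<Sum>j\<in>{1..n}. Poly_Mapping.single (w j) 1) = word_monomial n f"
      unfolding word_monomial_def by (intro sum.cong refl) (simp add: w)
    moreover have "w j = f j" "w (j + 1) = f (j + 1)" if "j \<in> {1..n - 1}" for j
      using that by (auto intro!: w)
    ultimately show ?thesis using f S by (auto simp: subset_iff)
  qed
  ultimately have "?X = (if \<forall>j\<in>S. f j < f (j + 1) then {w} else {})" by auto
  then show ?thesis unfolding fundamental_qsym_def by simp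
qed

lemma qsym_gf_word_monomial:
  assumes "finite A" "\<And>j. j \<in> {1..n} \<Longrightarrow> 1 \<le> f j" "\<forall>j\<in>{1..n - 1}. f j \<le> f (j + 1)"
  shows "qsym_gf n A (word_monomial n f) = int (card {\<pi> \<in> A. \<forall>j\<in>Des n \<pi>. f j < f (j + 1)})"
proof -
  have "qsym_gf n A (word_monomial n f) = (\<Sum>\<pi>\<in>A. of_bool (\<forall>j\<in>Des n \<pi>. f j < f (j + 1)))"
    unfolding qsym_gf_def using assms
    by (intro sum.cong refl fundamental_qsym_word_monomial) (auto simp: Des_def)
  then show ?thesis using assms(1) by (simp add: Int_def)
qed

text \<open>Precomposing exponents with \<open>\<rho>\<close> renames the letter
  \<open>\<rho> v\<close> to \<open>v\<close>. Since the order of factors is irrelevant, positions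
  may be permuted by \<open>\<rho>\<close> as well, which conjugates \<open>f\<close> into
  \<open>g\<close>.\<close>

lemma map_key_word_monomial:
  assumes \<rho>: "\<rho> permutes {1..n}" and comm: "\<And>l. l \<in> {1..n} \<Longrightarrow> f (\<rho> l) = \<rho> (g l)"
  shows "Poly_Mapping.map_key \<rho> (word_monomial n f) = word_monomial n g"
proof -
  have inj: "inj \<rho>" using \<rho> by (rule permutes_inj)
  have "word_monomial n f = (\<Sum>l\<in>{1..n}. Poly_Mapping.single (f (\<rho> l)) 1)"
    unfolding word_monomial_def using sum.permute[OF \<rho>] by (simp add: o_def)
  also have "\<dots> = (\<Sum>l\<in>{1..n}. Poly_Mapping.single (\<rho> (g l)) 1)"
    using comm by (intro sum.cong) auto
  also have "Poly_Mapping.map_key \<rho> \<dots> = (\<Sum>l\<in>{1..n}. Poly_Mapping.map_key \<rho> (Poly_Mapping.single (\<rho> (g l)) 1))"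
    by (rule sum_comp_morphism[symmetric, unfolded o_def])
      (simp_all add: map_key_zero[OF inj] map_key_plus[OF inj])
  also have "\<dots> = word_monomial n g"
    by (simp add: map_key_single[OF inj] word_monomial_def)
  finally show ?thesis .
qed

section \<open>Symmetry as equality of ascent counts\<close>

text \<open>Joining \<open>i\<close> and \<open>i + 1\<close> for every \<open>i \<in> U\<close>, this is the first position of the block of \<open>l\<close>. As a
  word in \<open>l\<close> it increases strictly exactly outside \<open>U\<close>. Naming blocks by positions lets a
  permutation of positions act as the permutation of variables too.\<close>

fun block_start :: "nat set \<Rightarrow> nat \<Rightarrow> nat" where
  "block_start U 0 = 0"
| "block_start U (Suc l) = (if l \<in> U then block_start U l else Suc l)"

lemma block_start_le: "block_start U l \<le> l"
  by (induction l) auto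

lemma block_start_pos:
  assumes "0 \<notin> U" "1 \<le> l"
  shows "1 \<le> block_start U l"
  using assms(2,1) by (induction l rule: dec_induct) auto

lemma block_start_mono_Suc: "block_start U l \<le> block_start U (l + 1)"
  using block_start_le[of U l] by simp

lemma block_start_less_Suc_iff: "block_start U l < block_start U (l + 1) \<longleftrightarrow> l \<notin> U"
  using block_start_le[of U l] by auto

text \<open>By \<open>Suc\<close> in the hypotheses, \<open>\<rho>\<close> moves each block for
  \<open>V\<close> as a rigid interval onto a block for \<open>U\<close>, so first positions go to
  first positions.\<close>

lemma block_start_permuted:
  assumes \<rho>: "\<rho> permutes {1..n}" and V: "V \<subseteq> {1..n - 1}" "\<rho> ` V = U"
    and Suc: "\<And>i. i \<in> V \<Longrightarrow> \<rho> (i + 1) = \<rho> i + 1"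
  shows "block_start U (\<rho> l) = \<rho> (block_start V l)"
proof (induction l)
  case 0
  then show ?case using permutes_not_in[OF \<rho>, of 0] by simp
next
  case (Suc l)
  show ?case
  proof (cases "l \<in> V")
    case True
    then show ?thesis using Suc.IH V assms(4)[of l] by auto
  next
    case False
    \<comment> \<open>Here \<open>Suc l\<close> opens a block for \<open>V\<close>; its image must
      open a block for \<open>U\<close>, so it may not be the successor of a point of
      \<open>U\<close>.\<close>
    have "\<rho> (Suc l) \<noteq> Suc v" if "v \<in> U" for v
    proof
      assume eq: "\<rho> (Suc l) = Suc v"
      from that V obtain t where "t \<in> V" "v = \<rho> t" by auto
      then have "\<rho> (Suc l) = \<rho> (Suc t)" using eq assms(4)[of t] by simp
      then show False using \<open>t \<in> V\<close> False permutes_inj[OF \<rho>] by (simp add: inj_eq)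
    qed
    then show ?thesis using False by (cases "\<rho> (Suc l)") auto
  qed
qed

text \<open>Ascent counts of the complement of \<open>P\<close> are coefficients at block monomials,
  which \<open>\<rho>\<close> exchanges as a permutation of variables. In all of
  \<open>Sym n\<close> the counts agree through composition with \<open>\<rho>\<close>, and
  subtraction leaves the counts for \<open>P\<close>.\<close>

lemma card_ascending_eq:
  assumes "P \<subseteq> Sym n" and sym: "symmetric_set n (Sym n - P)"
    and \<rho>: "\<rho> permutes {1..n}" and V: "V \<subseteq> {1..n - 1}" "\<rho> ` V = U" and U: "U \<subseteq> {1..n - 1}"
    and step: "\<And>i. i \<in> V \<Longrightarrow> \<rho> (i + 1) = \<rho> i + 1"
  shows "card {\<pi> \<in> P. Des n \<pi> \<inter> U = {}} = card {\<pi> \<in> P. Des n \<pi> \<inter> V = {}}"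
proof -
  have fin: "finite (Sym n)" by (simp add: Sym_def finite_permutations)
  have coeff: "qsym_gf n A (word_monomial n (block_start W)) = int (card {\<pi> \<in> A. Des n \<pi> \<inter> W = {}})"
    if "W \<subseteq> {1..n - 1}" "finite A" for A W
  proof -
    have "{\<pi> \<in> A. \<forall>j\<in>Des n \<pi>. block_start W j < block_start W (j + 1)} = {\<pi> \<in> A. Des n \<pi> \<inter> W = {}}"
      unfolding block_start_less_Suc_iff by auto
    moreover have "0 \<notin> W" using that by auto
    ultimately show ?thesis
      using qsym_gf_word_monomial[of A n "block_start W"] that
        block_start_pos[of W] block_start_mono_Suc[of W] by auto
  qed
  have "\<rho> permutes {1..}" using \<rho> by (rule permutes_subset) auto
  then have "qsym_gf n (Sym n - P) (Poly_Mapping.map_key \<rho> (word_monomial n (block_start U)))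
      = qsym_gf n (Sym n - P) (word_monomial n (block_start U))"
    using sym by (auto simp: symmetric_set_def symmetric_series_def)
  moreover have "Poly_Mapping.map_key \<rho> (word_monomial n (block_start U)) = word_monomial n (block_start V)"
    using \<rho> block_start_permuted[OF \<rho> V step] by (rule map_key_word_monomial)
  ultimately have compl: "card {\<pi> \<in> Sym n - P. Des n \<pi> \<inter> U = {}} = card {\<pi> \<in> Sym n - P. Des n \<pi> \<inter> V = {}}"
    using U V fin by (simp add: coeff)
  \<comment> \<open>A permutation has no ties, so a position that is not a descent is an
    ascent.\<close>
  have asc: "Des n \<pi> \<inter> W = {} \<longleftrightarrow> (\<forall>i\<in>W. \<pi> i < \<pi> (i + 1))" if "\<pi> \<in> Sym n" "W \<subseteq> {1..n - 1}" for \<pi> W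
  proof -
    have "\<pi> i \<noteq> \<pi> (i + 1)" for i
      using that(1) permutes_inj[of \<pi> "{1..n}"] by (auto simp: Sym_def inj_eq)
    then show ?thesis using that(2) by (fastforce simp: Des_def not_less_iff_gr_or_eq)
  qed
  have all: "card {\<pi> \<in> Sym n. Des n \<pi> \<inter> U = {}} = card {\<pi> \<in> Sym n. Des n \<pi> \<inter> V = {}}"
  proof (rule bij_betw_same_card)
    have iff: "Des n (\<pi> \<circ> \<rho>) \<inter> V = {} \<longleftrightarrow> Des n \<pi> \<inter> U = {}" if "\<pi> \<in> Sym n" for \<pi>
    proof -
      have "\<pi> \<circ> \<rho> \<in> Sym n" using that \<rho> by (auto simp: Sym_def intro: permutes_compose)
      then show ?thesis using that V U step by (auto simp: asc)
    qed
    show "bij_betw (\<lambda>\<pi>. \<pi> \<circ> \<rho>) {\<pi> \<in> Sym n. Des n \<pi> \<inter> U = {}} {\<pi> \<in> Sym n. Des n \<pi> \<inter> V = {}}"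
    proof (rule bij_betw_byWitness[where f' = "\<lambda>\<pi>. \<pi> \<circ> inv \<rho>"])
      show "\<forall>\<pi>\<in>{\<pi> \<in> Sym n. Des n \<pi> \<inter> U = {}}. \<pi> \<circ> \<rho> \<circ> inv \<rho> = \<pi>"
        "\<forall>\<pi>\<in>{\<pi> \<in> Sym n. Des n \<pi> \<inter> V = {}}. \<pi> \<circ> inv \<rho> \<circ> \<rho> = \<pi>"
        using \<rho> by (simp_all add: comp_assoc permutes_inv_o)
      show "(\<lambda>\<pi>. \<pi> \<circ> \<rho>) ` {\<pi> \<in> Sym n. Des n \<pi> \<inter> U = {}} \<subseteq> {\<pi> \<in> Sym n. Des n \<pi> \<inter> V = {}}"
        using \<rho> iff by (auto simp del: disjoint_iff) (auto simp: Sym_def intro: permutes_compose)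
      have "\<pi> \<circ> inv \<rho> \<in> Sym n" if "\<pi> \<in> Sym n" for \<pi>
        using that \<rho> by (auto simp: Sym_def intro: permutes_compose permutes_inv)
      moreover from this have "Des n \<pi> \<inter> V = {} \<longleftrightarrow> Des n (\<pi> \<circ> inv \<rho>) \<inter> U = {}" if "\<pi> \<in> Sym n" for \<pi>
        using that iff[of "\<pi> \<circ> inv \<rho>"] \<rho> by (simp add: comp_assoc permutes_inv_o)
      ultimately show "(\<lambda>\<pi>. \<pi> \<circ> inv \<rho>) ` {\<pi> \<in> Sym n. Des n \<pi> \<inter> V = {}} \<subseteq> {\<pi> \<in> Sym n. Des n \<pi> \<inter> U = {}}"
        by auto
    qed
  qed
  have "card {\<pi> \<in> P. Des n \<pi> \<inter> W = {}} = card {\<pi> \<in> Sym n. Des n \<pi> \<inter> W = {}}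
      - card {\<pi> \<in> Sym n - P. Des n \<pi> \<inter> W = {}}" for W
  proof -
    have "{\<pi> \<in> P. Des n \<pi> \<inter> W = {}} = {\<pi> \<in> Sym n. Des n \<pi> \<inter> W = {}} - {\<pi> \<in> Sym n - P. Des n \<pi> \<inter> W = {}}"
      using assms(1) by auto
    then show ?thesis using fin by (simp only:) (rule card_Diff_subset, auto)
  qed
  then show ?thesis using compl all by simp
qed

text \<open>Only the positions in \<open>V\<close> and their successors matter, so it is enough to
  prescribe the move there and extend it arbitrarily.\<close>

lemma card_ascending_eq_of_shift:
  assumes "P \<subseteq> Sym n" "symmetric_set n (Sym n - P)"
    and V: "V \<subseteq> {1..n - 1}" and g: "inj_on g (V \<union> Suc ` V)" "g ` (V \<union> Suc ` V) \<subseteq> {1..n}"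
    and "\<And>i. i \<in> V \<Longrightarrow> g (i + 1) = g i + 1"
  shows "card {\<pi> \<in> P. Des n \<pi> \<inter> g ` V = {}} = card {\<pi> \<in> P. Des n \<pi> \<inter> V = {}}"
proof -
  have "V \<union> Suc ` V \<subseteq> {1..n}" using V by fastforce
  then obtain \<rho> where \<rho>: "\<rho> permutes {1..n}" "\<And>x. x \<in> V \<union> Suc ` V \<Longrightarrow> \<rho> x = g x"
    using permutation_extending[OF _ _ g] by auto
  have "g i \<in> {1..n - 1}" if "i \<in> V" for i
  proof -
    have "g i \<in> {1..n}" "g (i + 1) \<in> {1..n}" using g(2) that by (simp_all add: image_subset_iff)
    then show ?thesis using assms(6)[OF that] by auto
  qed
  then show ?thesis
    using \<rho>(2) assms by (intro card_ascending_eq[OF assms(1,2) \<rho>(1)]) (auto simp: image_iff)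
qed

section \<open>Nonuniform descents and the conclusion\<close>

text \<open>Only the increasing and the decreasing permutation have all positions of the same kind,
  and \<open>P\<close> has more than two members.\<close>

lemma ex_nonuniform_descents:
  assumes "P \<subseteq> Sym n" "3 \<le> card P"
  shows "\<exists>\<pi>\<in>P. \<exists>i\<in>{1..<n - 1}. (i \<in> Des n \<pi>) \<noteq> (i + 1 \<in> Des n \<pi>)"
proof (rule ccontr)
  assume "\<not> ?thesis"
  then have const: "i \<in> Des n \<pi> \<longleftrightarrow> i + 1 \<in> Des n \<pi>" if "\<pi> \<in> P" "i \<in> {1..<n - 1}" for \<pi> i
    using that by blast
  have uniform: "i \<in> Des n \<pi> \<longleftrightarrow> 1 \<in> Des n \<pi>" if "\<pi> \<in> P" "1 \<le> i" "i \<le> n - 1" for \<pi> i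
    using that(2,3) by (induction i rule: dec_induct) (use const[OF that(1)] in auto)
  have "inj_on (\<lambda>\<pi>. 1 \<in> Des n \<pi>) P"
  proof (rule inj_onI)
    fix \<pi> \<sigma> assume P: "\<pi> \<in> P" "\<sigma> \<in> P" and eq: "(1 \<in> Des n \<pi>) = (1 \<in> Des n \<sigma>)"
    have mono: "\<tau> j < \<tau> j' \<longleftrightarrow> 1 \<notin> Des n \<tau>" if "\<tau> \<in> P" "1 \<le> j" "j < j'" "j' \<le> n" for \<tau> j j'
    proof -
      have "inj \<tau>" using that(1) assms(1) permutes_inj by (auto simp: Sym_def)
      then have ne: "\<tau> i \<noteq> \<tau> (Suc i)" for i by (simp add: inj_eq)
      have one: "\<tau> i < \<tau> (Suc i) \<longleftrightarrow> 1 \<notin> Des n \<tau>" if "1 \<le> i" "i < n" for i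
        proof -
        have "i \<le> n - 1" using that by simp
        then have "i \<in> Des n \<tau> \<longleftrightarrow> \<tau> (Suc i) < \<tau> i" using that by (simp add: Des_def)
        then show ?thesis
          using uniform[OF \<open>\<tau> \<in> P\<close> \<open>1 \<le> i\<close> \<open>i \<le> n - 1\<close>] ne[of i] by auto
      qed
      have "Suc j \<le> j'" using that by simp
      then show ?thesis using that(4)
      proof (induction j' rule: dec_induct)
        case base
        then show ?case using one[of j] that by simp
      next
        case (step l)
        then show ?case using one[of l] ne[of l] that \<open>inj \<tau>\<close>
          by (cases "1 \<in> Des n \<tau>") (auto simp: not_less)
      qed
    qed
    show "\<pi> = \<sigma>"
      using P assms(1) mono eq by (intro permutation_eq_of_same_order[of _ n]) (auto simp: Sym_def)
  qed
  then have "card P \<le> card (UNIV :: bool set)" by (rule card_inj_on_le) auto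
  then show False using assms(2) by simp
qed

theorem theorem1p4:
  fixes p k :: nat and P :: "(nat \<Rightarrow> nat) set"
  assumes "p \<ge> 3" and "k \<ge> p + 2"
    and "P \<subseteq> Sym k" and "card P = p"
  shows "\<not> symmetrically_avoided k P"
proof
  assume "symmetrically_avoided k P"
  then have sym: "symmetric_set k (Sym k - P)"
    using Avoiders_same_size[OF assms(3)] by (metis symmetrically_avoided_def)
  have fin: "finite P" using assms(1,4) card.infinite by fastforce
  define c where "c = (\<lambda>U. int (card {\<pi> \<in> P. Des k \<pi> \<inter> U = {}}))"
  define u where "u = (\<lambda>i \<pi>. of_bool (i \<notin> Des k \<pi>) :: int)"
  note eq = card_ascending_eq_of_shift[OF assms(3) sym]
  have c1: "c {i} = c {1}" if "i \<in> {1..k - 1}" for i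
  proof -
    have "1 \<le> i" "i + 1 \<le> k" using that by auto
    then show ?thesis using eq[of "{1}" "\<lambda>l. l - 1 + i"] by (auto simp: c_def)
  qed
  have c2: "c {i, i + 1} = c {1, 2}" if "i \<in> {1..k - 1}" "i + 1 \<in> {1..k - 1}" for i
  proof -
    let ?g = "\<lambda>l. l - 1 + i"
    have img: "?g ` {1, 2} = {i, i + 1}" by auto
    have "1 \<le> i" "i + 2 \<le> k" "3 \<le> k" using that assms by auto
    then have "card {\<pi> \<in> P. Des k \<pi> \<inter> ?g ` {1, 2} = {}} = card {\<pi> \<in> P. Des k \<pi> \<inter> {1, 2} = {}}"
      by (intro eq) (auto simp: inj_on_def)
    then show ?thesis unfolding img by (simp add: c_def)
  qed
  have c3: "c {i, j} = c {1, 3}" if "i \<in> {1..k - 1}" "j \<in> {1..k - 1}" "i + 2 \<le> j" for i j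
  proof -
    \<comment> \<open>The positions 1, 2 go to \<open>i\<close>, \<open>i + 1\<close> and the
      positions 3, 4 to \<open>j\<close>, \<open>j + 1\<close>; \<open>i + 2 \<le> j\<close> keeps
      the two images disjoint.\<close>
    let ?g = "\<lambda>l. if l \<le> 2 then l - 1 + i else l - 3 + j"
    have img: "?g ` {1, 3} = {i, j}" by auto
    have "1 \<le> i" "i + 2 \<le> j" "j + 1 \<le> k" "4 \<le> k" using that assms by auto
    then have "card {\<pi> \<in> P. Des k \<pi> \<inter> ?g ` {1, 3} = {}} = card {\<pi> \<in> P. Des k \<pi> \<inter> {1, 3} = {}}"
      by (intro eq) auto
    then show ?thesis unfolding img by (simp add: c_def)
  qed
  have pair: "c {i, j} = (if i = j then c {1} else if j = i + 1 \<or> i = j + 1 then c {1, 2} else c {1, 3})"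
    if "i \<in> {1..k - 1}" "j \<in> {1..k - 1}" for i j
    using that c1[of i] c2[of i] c2[of j] c3[of i j] c3[of j i]
    by (cases i j rule: linorder_cases) (auto simp: insert_commute)
  interpret adjacency_gram P u "k - 1" "c {1}" "c {1, 2}" "c {1, 3}"
  proof
    show "u i \<pi> = 0 \<or> u i \<pi> = 1" for i \<pi> by (simp add: u_def)
    fix i j assume ij: "i \<in> {1..k - 1}" "j \<in> {1..k - 1}"
    have "(\<Sum>\<pi>\<in>P. u i \<pi> * u j \<pi>) = (\<Sum>\<pi>\<in>P. of_bool (Des k \<pi> \<inter> {i, j} = {}))"
      by (intro sum.cong) (auto simp: u_def)
    also have "\<dots> = c {i, j}" using fin by (simp add: c_def Int_def)
    finally show "(\<Sum>\<pi>\<in>P. u i \<pi> * u j \<pi>)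
        = (if i = j then c {1} else if j = i + 1 \<or> i = j + 1 then c {1, 2} else c {1, 3})"
      by (simp only: pair[OF ij])
  qed (rule fin)
  obtain \<pi> i where "\<pi> \<in> P" "i \<in> {1..<k - 1}" "(i \<in> Des k \<pi>) \<noteq> (i + 1 \<in> Des k \<pi>)"
    using ex_nonuniform_descents[OF assms(3)] assms(1,4) by blast
  \<comment> \<open>There are \<open>k - 1 \<ge> p + 1 \<ge> 4\<close> columns, so the bound applies
    and exceeds \<open>card P = p\<close>.\<close>
  then have "k - 1 \<le> card P"
    using assms(1,2) by (intro card_ge[of \<pi> i]) (auto simp: u_def)
  then show False using assms by simp
qed

end
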